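(* If $I\subset E=\{m+ni:(m,n)\in\mathbb N\times\mathbb Z\}$ is porous in $E$ (i.e. $\overline{J_I}$ is porous in $\mathbb C$), then $\overline\rho_E(I)<1$, where $$\overline\rho_E(I)=\limsup_{R\to+\infty}\frac{\sharp\,(I\cap\overline B_\infty(1,R))}{\sharp\,(E\cap\overline B_\infty(1,R))}$$ is the upper density of $I$ in $E$.
   Context: $\mathbb N=\{1,2,\dots\}$. $\overline B_\infty(z,r)$ is the closed ball centered at $z$ of radius $r$ for the norm $\|w\|_\infty=\max\{|\operatorname{Re}w|,|\operatorname{Im}w|\}$ on $\mathbb C$. Let $X=\overline B(1/2,1/2)\subset\mathbb C$ and $\phi_e:X\to X$, $\phi_e(z)=1/(e+z)$, for $e\in E$. For $\omega\in I^{\mathbb N}$, $\pi(\omega)$ is the unique point of $\bigcap_n\phi_{\omega_1}\circ\cdots\circ\phi_{\omega_n}(X)$, and $J_I=\pi(I^{\mathbb N})$ is the limit set of the complex continued fractions system $\{\phi_e\}_{e\in I}$; $\overline{J_I}$ is its closure in $\mathbb C$. Porosity (in $\mathbb C$, Euclidean metric): for a bounded $G\subset\mathbb C$, $x\in\mathbb C$, $r>0$, $\operatorname{por}(G,x,r)=\sup\{c\ge0: B(y,cr)\subset B(x,r)\setminus G\text{ for some }y\in\mathbb C\}$. $G$ is porous if there are $c\in(0,1)$, $r_0>0$ with $\operatorname{por}(G,x,r)\ge c$ for all $x\in G$ and $r\in(0,r_0)$. *)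

theory Defs
  imports "HOL-Analysis.Analysis"
begin

definition cf_alphabet :: "complex set" where
  "cf_alphabet = {Complex (of_nat m) (of_int n) | (m::nat) (n::int). m \<ge> 1}"

definition cf_domain :: "complex set" where
  "cf_domain = cball (1/2) (1/2)"

definition cf_map :: "complex \<Rightarrow> complex \<Rightarrow> complex" where
  "cf_map e z = 1 / (e + z)"

text \<open>Infinite words are functions on \<^typ>\<open>nat\<close> indexed from 0, so \<open>\<omega> k\<close> is the letter
  \<open>\<omega>\<^sub>k\<^sub>+\<^sub>1\<close>, and \<open>cf_word_map \<omega> n\<close> is the composition of the maps of the first \<open>n\<close> letters,
  the first letter being applied last.\<close>

primrec cf_word_map :: "(nat \<Rightarrow> complex) \<Rightarrow> nat \<Rightarrow> complex \<Rightarrow> complex" where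
  "cf_word_map \<omega> 0 = id"
| "cf_word_map \<omega> (Suc n) = cf_word_map \<omega> n \<circ> cf_map (\<omega> n)"

definition cf_proj :: "(nat \<Rightarrow> complex) \<Rightarrow> complex" where
  "cf_proj \<omega> = (THE z. z \<in> (\<Inter>n\<in>{1..}. cf_word_map \<omega> n ` cf_domain))"

definition cf_limit_set :: "complex set \<Rightarrow> complex set" where
  "cf_limit_set I = cf_proj ` {\<omega>. \<forall>k. \<omega> k \<in> I}"

text \<open>For \<open>r > 0\<close> the set below contains 0 (the ball of radius 0 is empty) and is bounded above
  by 1, so the real supremum is the genuine one.\<close>

definition por :: "complex set \<Rightarrow> complex \<Rightarrow> real \<Rightarrow> real" where
  "por G x r = Sup {c. c \<ge> 0 \<and> (\<exists>y. ball y (c * r) \<subseteq> ball x r - G)}"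

text \<open>Porosity is only meant for bounded sets; it is applied here to closures of limit sets of
  subsets of \<open>cf_alphabet\<close>, which are contained in \<open>cf_domain\<close>.\<close>

definition porous :: "complex set \<Rightarrow> bool" where
  "porous G \<longleftrightarrow> (\<exists>c r0. 0 < c \<and> c < 1 \<and> r0 > 0 \<and>
     (\<forall>x\<in>G. \<forall>r. 0 < r \<and> r < r0 \<longrightarrow> por G x r \<ge> c))"

definition porous_in_alphabet :: "complex set \<Rightarrow> bool" where
  "porous_in_alphabet I \<longleftrightarrow> porous (closure (cf_limit_set I))"

definition cball_max :: "complex \<Rightarrow> real \<Rightarrow> complex set" where
  "cball_max z r = {w. max \<bar>Re (w - z)\<bar> \<bar>Im (w - z)\<bar> \<le> r}"

definition upper_density :: "complex set \<Rightarrow> complex set \<Rightarrow> ereal" where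
  "upper_density E I = Limsup at_top (\<lambda>R::real.
     ereal (real (card (I \<inter> cball_max 1 R)) / real (card (E \<inter> cball_max 1 R))))"

end

theory Submission
  imports Defs
begin

text \<open>Fix \<open>z\<^sub>0 \<in> J\<^sub>I\<close>; then \<open>1 / (e + z\<^sub>0) \<in> J\<^sub>I\<close> for every \<open>e \<in> I\<close>. For large \<open>R\<close>, either \<open>I\<close> has no
  element within a small multiple of \<open>R\<close> of the point \<open>R/2\<close>, or porosity at \<open>1 / (e + z\<^sub>0)\<close> for such an element \<open>e\<close>, at a scale
  comparable to \<open>1/R\<close>, gives a hole of \<open>J\<^sub>I\<close> whose image under \<open>z \<mapsto> 1/z\<close> contains a ball of
  radius comparable to \<open>R\<close> inside the square \<open>cball_max 1 R\<close>. No point of \<open>I\<close> lies in that ball,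
  up to a bounded margin, so \<open>I\<close> misses a fixed proportion of the alphabet in the square. The
  base point is taken near \<open>R/2\<close>, away from the boundary of the half plane, to keep the hole inside
  the region covered by the images of the alphabet.\<close>

subsection \<open>The limit set\<close>

text \<open>Integer coordinates on both axes allow letters to be counted through floor and ceiling
  intervals.\<close>

lemma cf_alphabet_altdef:
  "cf_alphabet = (\<lambda>(a, b). Complex (of_int a) (of_int b)) ` ({1..} \<times> UNIV)"
proof (intro set_eqI iffI)
  fix e assume "e \<in> cf_alphabet"
  then obtain m n where "e = Complex (of_nat m) (of_int n)" "m \<ge> 1"
    by (auto simp: cf_alphabet_def)
  then show "e \<in> (\<lambda>(a, b). Complex (of_int a) (of_int b)) ` ({1..} \<times> UNIV)"
    by (intro image_eqI[of _ _ "(int m, n)"]) auto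
next
  fix e assume "e \<in> (\<lambda>(a, b). Complex (of_int a) (of_int b)) ` ({1..} \<times> UNIV)"
  then obtain a b where e: "e = Complex (of_int a) (of_int b)" "a \<ge> 1" by auto
  then have "e = Complex (of_nat (nat a)) (of_int b)" "nat a \<ge> 1" by auto
  then show "e \<in> cf_alphabet" unfolding cf_alphabet_def by blast
qed

lemma Re_cf_alphabet: "e \<in> cf_alphabet \<Longrightarrow> Re e \<ge> 1"
  by (auto simp: cf_alphabet_def)

text \<open>Squaring the inequality of the disc cancels the constant 1/4. In this form the disc is
  visibly the inverse of the half plane \<open>Re u \<ge> 1\<close>, together with 0.\<close>

lemma cf_domain_iff: "z \<in> cf_domain \<longleftrightarrow> (cmod z)\<^sup>2 \<le> Re z"
proof -
  have "z \<in> cf_domain \<longleftrightarrow> (cmod (1/2 - z))\<^sup>2 \<le> (1/2)\<^sup>2"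
    unfolding cf_domain_def mem_cball dist_norm
    by (metis abs_le_square_iff abs_norm_cancel abs_of_nonneg zero_le_divide_1_iff zero_le_numeral)
  also have "(cmod (1/2 - z))\<^sup>2 = (cmod z)\<^sup>2 - Re z + 1/4"
    unfolding cmod_power2 by (simp add: power2_eq_square algebra_simps)
  also have "\<dots> \<le> (1/2)\<^sup>2 \<longleftrightarrow> (cmod z)\<^sup>2 \<le> Re z"
    by (simp add: power2_eq_square)
  finally show ?thesis .
qed

lemma cf_domain_Re_nonneg: "z \<in> cf_domain \<Longrightarrow> Re z \<ge> 0"
  unfolding cf_domain_iff by (meson order_trans zero_le_power2)

lemma cf_domain_norm_le: "z \<in> cf_domain \<Longrightarrow> cmod z \<le> 1"
  using norm_triangle_ineq2[of z "1/2"] by (simp add: cf_domain_def dist_norm norm_minus_commute)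

lemma cf_domain_nonempty: "cf_domain \<noteq> {}"
  by (simp add: cf_domain_def)

lemma Re_denominator_ge_1:
  "e \<in> cf_alphabet \<Longrightarrow> z \<in> cf_domain \<Longrightarrow> Re (e + z) \<ge> 1"
  using Re_cf_alphabet cf_domain_Re_nonneg by fastforce

lemma denominator_nonzero: "e \<in> cf_alphabet \<Longrightarrow> z \<in> cf_domain \<Longrightarrow> e + z \<noteq> 0"
  using Re_denominator_ge_1 by fastforce

lemma cf_map_in_domain:
  assumes "e \<in> cf_alphabet" "z \<in> cf_domain"
  shows "cf_map e z \<in> cf_domain"
proof -
  define u where "u = e + z"
  have "Re u \<ge> 1" using Re_denominator_ge_1[OF assms] by (simp add: u_def)
  then have "cmod u > 0" by auto
  have "Re (1 / u) = Re u / (cmod u)\<^sup>2" by (simp add: Re_divide cmod_power2)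
  moreover have "(cmod (1 / u))\<^sup>2 = 1 / (cmod u)\<^sup>2" by (simp add: norm_divide power_divide)
  ultimately show ?thesis
    using \<open>Re u \<ge> 1\<close> \<open>cmod u > 0\<close> by (simp add: cf_map_def cf_domain_iff u_def divide_right_mono)
qed

lemma continuous_on_cf_map: "e \<in> cf_alphabet \<Longrightarrow> continuous_on cf_domain (cf_map e)"
  unfolding cf_map_def by (intro continuous_intros) (auto dest: denominator_nonzero)

lemma cf_word_map_in_domain:
  assumes "\<And>k. \<omega> k \<in> cf_alphabet"
  shows "z \<in> cf_domain \<Longrightarrow> cf_word_map \<omega> n z \<in> cf_domain"
  by (induction n arbitrary: z) (auto simp: assms cf_map_in_domain)

lemma continuous_on_cf_word_map:
  assumes "\<And>k. \<omega> k \<in> cf_alphabet"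
  shows "continuous_on cf_domain (cf_word_map \<omega> n)"
proof (induction n)
  case (Suc n)
  have "cf_map (\<omega> n) ` cf_domain \<subseteq> cf_domain" using assms cf_map_in_domain by auto
  then show ?case
    unfolding cf_word_map.simps
    by (intro continuous_on_compose continuous_on_cf_map assms continuous_on_subset[OF Suc])
qed auto

text \<open>Letters are appended innermost, so prepending one composes on the outside.\<close>

lemma cf_word_map_case_nat:
  "cf_word_map (case_nat e \<omega>) (Suc n) = cf_map e \<circ> cf_word_map \<omega> n"
proof (induction n)
  case (Suc n)
  then show ?case
    by (simp only: cf_word_map.simps(2)[of _ "Suc n"] cf_word_map.simps(2)[of \<omega> n] comp_assoc nat.case)
qed simp

section \<open>Contraction of two-letter compositions\<close>

text \<open>The squared product is the reciprocal of the modulus of the derivative of the two-letter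
  composition at \<open>z\<close>. With \<open>t = cmod (f + z)\<close>, the point
  \<open>cf_map f z\<close> of the disc has real part at least its squared modulus 1/t^2, so the
  product is at least (1 + 1/t^2) t = t + 1/t, hence at least 2.\<close>

lemma two_step_denominator_ge_2:
  assumes "e \<in> cf_alphabet" "f \<in> cf_alphabet" "z \<in> cf_domain"
  shows "cmod (e + cf_map f z) * cmod (f + z) \<ge> 2"
proof -
  define t where "t = cmod (f + z)"
  have t: "t > 0" using denominator_nonzero[OF assms(2,3)] by (simp add: t_def)
  have n: "cmod (cf_map f z) = 1 / t" by (simp add: cf_map_def t_def norm_divide)
  have "1 + 1 / t\<^sup>2 \<le> Re e + Re (cf_map f z)"
    using Re_cf_alphabet[OF assms(1)] cf_map_in_domain[OF assms(2,3)]
    by (simp add: cf_domain_iff n power_divide)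
  also have "\<dots> \<le> cmod (e + cf_map f z)"
    using complex_Re_le_cmod[of "e + cf_map f z"] by simp
  finally have "(1 + 1 / t\<^sup>2) * t \<le> cmod (e + cf_map f z) * t"
    using t by (intro mult_right_mono) auto
  moreover have "(1 + 1 / t\<^sup>2) * t = 2 + (t - 1)\<^sup>2 / t"
    using t by (simp add: field_simps power2_eq_square)
  moreover have "(t - 1)\<^sup>2 / t \<ge> 0" using t by simp
  ultimately show ?thesis unfolding t_def by linarith
qed

lemma dist_cf_map:
  assumes "e \<in> cf_alphabet" "z \<in> cf_domain" "w \<in> cf_domain"
  shows "dist (cf_map e z) (cf_map e w) = dist z w / (cmod (e + z) * cmod (e + w))"
proof -
  have "cf_map e z - cf_map e w = (w - z) / ((e + z) * (e + w))"
    using denominator_nonzero[OF assms(1,2)] denominator_nonzero[OF assms(1,3)]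
    by (simp add: cf_map_def diff_frac_eq)
  then show ?thesis by (simp add: dist_norm norm_divide norm_mult norm_minus_commute)
qed

text \<open>A single map need not contract uniformly: the derivative of \<open>\<phi>\<^sub>1\<close> at 0 has modulus 1.\<close>

lemma dist_cf_map_cf_map:
  assumes "e \<in> cf_alphabet" "f \<in> cf_alphabet" "z \<in> cf_domain" "w \<in> cf_domain"
  shows "dist (cf_map e (cf_map f z)) (cf_map e (cf_map f w)) \<le> dist z w / 4"
proof -
  define A where "A = cmod (e + cf_map f z) * cmod (f + z)"
  define B where "B = cmod (e + cf_map f w) * cmod (f + w)"
  have AB: "A \<ge> 2" "B \<ge> 2"
    unfolding A_def B_def using assms by (auto intro: two_step_denominator_ge_2)
  have "2 * 2 \<le> A * B" using AB by (intro mult_mono) auto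
  \<comment> \<open>The exact distance formula is applied twice; the four denominators regroup into
    one product for \<open>z\<close> and one for \<open>w\<close>.\<close>
  have "dist (cf_map e (cf_map f z)) (cf_map e (cf_map f w)) = dist z w / (A * B)"
    using assms by (simp add: dist_cf_map cf_map_in_domain A_def B_def mult_ac)
  also have "\<dots> \<le> dist z w / 4"
    using \<open>2 * 2 \<le> A * B\<close> by (intro divide_left_mono) auto
  finally show ?thesis .
qed

lemma dist_cf_word_map:
  assumes "\<And>k. \<omega> k \<in> cf_alphabet"
  shows "z \<in> cf_domain \<Longrightarrow> w \<in> cf_domain \<Longrightarrow>
    dist (cf_word_map \<omega> (2 * n) z) (cf_word_map \<omega> (2 * n) w) \<le> dist z w / 4 ^ n"
proof (induction n arbitrary: z w)
  case (Suc n)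
  let ?g = "\<lambda>z. cf_map (\<omega> (2 * n)) (cf_map (\<omega> (Suc (2 * n))) z)"
  have "dist (cf_word_map \<omega> (2 * n) (?g z)) (cf_word_map \<omega> (2 * n) (?g w)) \<le> dist (?g z) (?g w) / 4 ^ n"
    using Suc.prems assms by (intro Suc.IH) (auto intro: cf_map_in_domain)
  also have "\<dots> \<le> (dist z w / 4) / 4 ^ n"
    using Suc.prems assms by (intro divide_right_mono dist_cf_map_cf_map) auto
  finally show ?case by simp
qed auto

section \<open>Coding of limit points\<close>

text \<open>Nested nonempty compact images have a common point, and the images at depth 2n have
  diameter at most 1/4^n, which excludes a second one. This justifies the definite description in
  \<open>cf_proj\<close>.\<close>

lemma cf_proj_ex1:
  assumes "\<And>k. \<omega> k \<in> cf_alphabet"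
  shows "\<exists>!z. z \<in> (\<Inter>n\<in>{1..}. cf_word_map \<omega> n ` cf_domain)"
proof -
  define F where "F n = cf_word_map \<omega> (Suc n) ` cf_domain" for n
  have eq: "(\<Inter>n\<in>{1..}. cf_word_map \<omega> n ` cf_domain) = (\<Inter>n. F n)"
  proof -
    have "{1..} = range Suc" by (auto simp: image_iff Suc_le_eq gr0_conv_Suc)
    then show ?thesis by (simp add: F_def image_image del: cf_word_map.simps)
  qed
  have "\<Inter> (range F) \<noteq> {}"
  proof (rule compact_nest)
    show "compact (F n)" for n
      unfolding F_def
      by (intro compact_continuous_image continuous_on_cf_word_map assms) (simp add: cf_domain_def)
    show "F n \<noteq> {}" for n by (simp add: F_def cf_domain_nonempty)
    \<comment> \<open>The extra letter acts innermost and maps the disc into itself.\<close>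
    have "F (Suc n) \<subseteq> F n" for n
      unfolding F_def cf_word_map.simps(2)[of \<omega> "Suc n"] image_comp[symmetric]
      using cf_map_in_domain assms by (intro image_mono) auto
    then show "F n \<subseteq> F m" if "m \<le> n" for m n
      using lift_Suc_antimono_le[of F] that by blast
  qed
  then obtain z where z: "z \<in> (\<Inter>n. F n)" by auto
  have "y = z" if y: "y \<in> (\<Inter>n. F n)" for y
  proof (rule ccontr)
    assume "y \<noteq> z"
    then have "dist y z > 0" by simp
    have le: "dist y z \<le> (1/4) ^ n" if "n > 0" for n
    proof -
      \<comment> \<open>The family \<open>F\<close> is shifted by one, so depth 2n is
        \<open>F (2 * n - 1)\<close>.\<close>
      have n: "2 * n = Suc (2 * n - 1)" using that by simp
      have "y \<in> cf_word_map \<omega> (2 * n) ` cf_domain" "z \<in> cf_word_map \<omega> (2 * n) ` cf_domain"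
        using y z by (subst n; auto simp: F_def simp del: cf_word_map.simps)+
      then obtain y' z' where *: "y' \<in> cf_domain" "z' \<in> cf_domain"
        "y = cf_word_map \<omega> (2 * n) y'" "z = cf_word_map \<omega> (2 * n) z'" by blast
      have "dist y' z' \<le> 1"
        using *(1,2) dist_triangle_le[of y' "1/2" z' 1] unfolding cf_domain_def
        by (simp add: dist_commute)
      then have "dist y' z' / 4 ^ n \<le> 1 / 4 ^ n" by (intro divide_right_mono) auto
      then show ?thesis
        using dist_cf_word_map[of \<omega>, OF assms *(1,2), of n] *(3,4) by (simp add: power_divide)
    qed
    obtain n where "(1/4) ^ n < dist y z"
      using real_arch_pow_inv[OF \<open>dist y z > 0\<close>, of "1/4"] by auto
    then have "(1/4) ^ Suc n < dist y z" by (simp add: field_simps)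
    then show False using le[of "Suc n"] by linarith
  qed
  with z show ?thesis unfolding eq by (rule ex1I)
qed

lemma cf_proj_in_image:
  assumes "\<And>k. \<omega> k \<in> cf_alphabet"
  shows "cf_proj \<omega> \<in> cf_word_map \<omega> n ` cf_domain"
proof -
  have *: "cf_proj \<omega> \<in> (\<Inter>n\<in>{1..}. cf_word_map \<omega> n ` cf_domain)"
    unfolding cf_proj_def by (rule theI'[OF cf_proj_ex1[OF assms]])
  show ?thesis
  proof (cases n)
    case 0
    have "cf_proj \<omega> \<in> cf_word_map \<omega> 1 ` cf_domain" using * by blast
    then show ?thesis using cf_map_in_domain assms 0 by auto
  next
    case (Suc k)
    then have "n \<in> {1..}" by simp
    with * show ?thesis by blast
  qed
qed

text \<open>The right-hand side lies in every image set of the prefixed word, and uniqueness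
  identifies it with the point coded by that word.\<close>

lemma cf_proj_case_nat:
  assumes "\<And>k. \<omega> k \<in> cf_alphabet" "e \<in> cf_alphabet"
  shows "cf_proj (case_nat e \<omega>) = cf_map e (cf_proj \<omega>)"
proof -
  have *: "case_nat e \<omega> k \<in> cf_alphabet" for k using assms by (cases k) auto
  have "cf_map e (cf_proj \<omega>) \<in> cf_word_map (case_nat e \<omega>) n ` cf_domain" if n1: "n \<ge> 1" for n
  proof -
    obtain k where n: "n = Suc k" using n1 by (cases n) auto
    show ?thesis
      unfolding n cf_word_map_case_nat image_comp[symmetric]
      by (intro imageI cf_proj_in_image assms)
  qed
  then show ?thesis
    unfolding cf_proj_def[of "case_nat e \<omega>"] by (intro the1_equality cf_proj_ex1 *) auto
qed

lemma cf_limit_set_subset: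
  assumes "I \<subseteq> cf_alphabet"
  shows "cf_limit_set I \<subseteq> cf_domain"
  unfolding cf_limit_set_def using cf_proj_in_image[of _ 0] assms by auto

lemma cf_limit_set_nonempty: "I \<noteq> {} \<Longrightarrow> cf_limit_set I \<noteq> {}"
  by (auto simp: cf_limit_set_def intro!: exI[of _ "\<lambda>_. SOME e. e \<in> I"] some_in_eq[THEN iffD2])

text \<open>Prefixing a letter of \<open>I\<close> to a code over \<open>I\<close> gives another
  such code. Applied to one fixed base point, this places an image of every letter of
  \<open>I\<close> in the limit set.\<close>

lemma cf_map_in_limit_set:
  assumes "I \<subseteq> cf_alphabet" "e \<in> I" "z \<in> cf_limit_set I"
  shows "cf_map e z \<in> cf_limit_set I"
proof -
  obtain \<omega> where \<omega>: "z = cf_proj \<omega>" "\<And>k. \<omega> k \<in> I"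
    using assms(3) by (auto simp: cf_limit_set_def)
  have "cf_map e z = cf_proj (case_nat e \<omega>)"
    using \<omega> assms by (subst cf_proj_case_nat) auto
  moreover have "case_nat e \<omega> k \<in> I" for k using \<omega> assms by (cases k) auto
  ultimately show ?thesis by (auto simp: cf_limit_set_def)
qed

subsection \<open>Counting\<close>

lemma card_int_interval_ge: "real (card {\<lceil>a\<rceil>..\<lfloor>b\<rfloor>}) \<ge> b - a - 1" for a b :: real
proof -
  have "real (card {\<lceil>a\<rceil>..\<lfloor>b\<rfloor>}) \<ge> real_of_int (\<lfloor>b\<rfloor> + 1 - \<lceil>a\<rceil>)" by simp
  moreover have "real_of_int (\<lfloor>b\<rfloor> + 1 - \<lceil>a\<rceil>) \<ge> b - a - 1" by simp linarith
  ultimately show ?thesis by linarith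
qed

lemma inj_Complex_of_int: "inj_on (\<lambda>(a, b). Complex (of_int a) (of_int b)) S"
  by (auto simp: inj_on_def)

text \<open>There are at most R + 1 columns and 2R + 1 rows; \<open>R \<ge> 1\<close> bounds these
  by 2R and 3R.\<close>

lemma card_cf_alphabet_square:
  assumes "R \<ge> 1"
  shows "finite (cf_alphabet \<inter> cball_max 1 R)"
    and "real (card (cf_alphabet \<inter> cball_max 1 R)) \<le> 6 * R\<^sup>2"
proof -
  define S where "S = {1..\<lfloor>1 + R\<rfloor>} \<times> {-\<lfloor>R\<rfloor>..\<lfloor>R\<rfloor>}"
  let ?f = "\<lambda>(a, b). Complex (real_of_int a) (real_of_int b)"
  have sub: "cf_alphabet \<inter> cball_max 1 R \<subseteq> ?f ` S"
  proof
    fix e assume e: "e \<in> cf_alphabet \<inter> cball_max 1 R"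
    then obtain a b where ab: "e = ?f (a, b)" "a \<ge> 1" by (auto simp: cf_alphabet_altdef)
    with e have "(a, b) \<in> S"
      by (auto simp: S_def cball_max_def le_floor_iff abs_le_iff) linarith+
    with ab show "e \<in> ?f ` S" by blast
  qed
  have fin: "finite S" by (simp add: S_def)
  then show "finite (cf_alphabet \<inter> cball_max 1 R)"
    using sub finite_subset by blast
  have "card (cf_alphabet \<inter> cball_max 1 R) \<le> card S"
    using fin sub surj_card_le by blast
  also have "card S = nat (\<lfloor>R\<rfloor> + 1) * nat (2 * \<lfloor>R\<rfloor> + 1)"
    by (simp add: S_def card_cartesian_product add.commute)
  finally have "real (card (cf_alphabet \<inter> cball_max 1 R)) \<le> real (nat (\<lfloor>R\<rfloor> + 1)) * real (nat (2 * \<lfloor>R\<rfloor> + 1))"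
    by (metis of_nat_le_iff of_nat_mult)
  also have "\<dots> \<le> (2 * R) * (3 * R)"
    using assms by (intro mult_mono) linarith+
  finally show "real (card (cf_alphabet \<inter> cball_max 1 R)) \<le> 6 * R\<^sup>2"
    by (simp add: power2_eq_square)
qed

text \<open>The axis-parallel square of side \<open>\<rho>\<close> centred at \<open>w\<close> fits
  in the ball, and each side interval holds at least \<open>\<rho> - 1\<close> integers. The bound
  on \<open>Re w\<close> keeps the square in the open right half plane, where every Gaussian integer
  is a letter.\<close>

lemma card_cf_alphabet_ball_ge:
  assumes "\<rho> \<ge> 1" "Re w \<ge> \<rho>" "finite A" "cf_alphabet \<inter> ball w \<rho> \<subseteq> A"
  shows "real (card A) \<ge> (\<rho> - 1)\<^sup>2"
proof -
  define S where "S = {\<lceil>Re w - \<rho>/2\<rceil>..\<lfloor>Re w + \<rho>/2\<rfloor>} \<times> {\<lceil>Im w - \<rho>/2\<rceil>..\<lfloor>Im w + \<rho>/2\<rfloor>}"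
  let ?f = "\<lambda>(a, b). Complex (real_of_int a) (real_of_int b)"
  have "?f ` S \<subseteq> A"
  proof (intro subset_trans[OF _ assms(4)] image_subsetI)
    fix p assume "p \<in> S"
    then obtain a b where p: "p = (a, b)"
      and ab: "Re w - \<rho>/2 \<le> a" "a \<le> Re w + \<rho>/2" "Im w - \<rho>/2 \<le> b" "b \<le> Im w + \<rho>/2"
      by (cases p) (auto simp: S_def ceiling_le_iff le_floor_iff)
    have "real_of_int a > 0" using ab assms(1,2) by linarith
    then have "a \<ge> 1" by simp
    then have "?f p \<in> cf_alphabet" by (force simp: cf_alphabet_altdef p)
    moreover have "dist w (?f p) < \<rho>"
    proof -
      have "(Re w - a)\<^sup>2 \<le> (\<rho>/2)\<^sup>2" "(Im w - b)\<^sup>2 \<le> (\<rho>/2)\<^sup>2"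
        using ab assms(1) unfolding abs_le_square_iff[symmetric] by linarith+
      then have "(dist w (?f p))\<^sup>2 \<le> 2 * (\<rho>/2)\<^sup>2"
        by (simp add: dist_norm cmod_power2 p)
      also have "\<dots> < \<rho>\<^sup>2" using assms(1) by (simp add: power2_eq_square)
      finally show ?thesis using assms(1) by (simp add: power_less_imp_less_base)
    qed
    ultimately show "?f p \<in> cf_alphabet \<inter> ball w \<rho>" by simp
  qed
  then have "card S \<le> card A"
    using card_mono[OF assms(3)] card_image[OF inj_Complex_of_int, of S] by metis
  moreover have "(\<rho> - 1)\<^sup>2 \<le> real (card S)"
    unfolding S_def card_cartesian_product of_nat_mult power2_eq_square
    using assms(1) card_int_interval_ge[where a = "Re w - \<rho>/2" and b = "Re w + \<rho>/2"]
      card_int_interval_ge[where a = "Im w - \<rho>/2" and b = "Im w + \<rho>/2"]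
    by (intro mult_mono) linarith+
  ultimately show ?thesis by linarith
qed

subsection \<open>Holes\<close>

text \<open>A supremum need not be attained, so the constant is halved to get an actual
  hole.\<close>

lemma porous_obtains_hole:
  assumes "porous G"
  obtains c r0 where "0 < c" "c < 1" "r0 > 0"
    "\<And>x r. x \<in> G \<Longrightarrow> 0 < r \<Longrightarrow> r < r0 \<Longrightarrow> \<exists>y. ball y (c * r) \<subseteq> ball x r - G"
proof -
  obtain c r0 where c: "0 < c" "c < 1" "r0 > 0"
    and por: "\<And>x r. x \<in> G \<Longrightarrow> 0 < r \<Longrightarrow> r < r0 \<Longrightarrow> por G x r \<ge> c"
    using assms unfolding porous_def by blast
  have "\<exists>y. ball y (c/2 * r) \<subseteq> ball x r - G" if x: "x \<in> G" "0 < r" "r < r0" for x r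
  proof -
    let ?C = "{c. c \<ge> 0 \<and> (\<exists>y. ball y (c * r) \<subseteq> ball x r - G)}"
    have "0 \<in> ?C" by simp
    moreover have "c/2 < Sup ?C" using por[OF x] c by (simp add: por_def)
    ultimately obtain d where "d \<in> ?C" "c/2 < d" using less_cSupD[of ?C "c/2"] by blast
    then obtain y where "ball y (d * r) \<subseteq> ball x r - G" by blast
    moreover have "ball y (c/2 * r) \<subseteq> ball y (d * r)"
      using \<open>c/2 < d\<close> x by (intro subset_ball mult_right_mono) auto
    ultimately show ?thesis by blast
  qed
  then show thesis using that[of "c/2" r0] c by auto
qed

lemma dist_inverse: "a \<noteq> 0 \<Longrightarrow> b \<noteq> 0 \<Longrightarrow> dist (1 / a) (1 / b) = dist a b / (cmod a * cmod b)"
  for a b :: complex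
  by (simp add: dist_norm diff_frac_eq norm_divide norm_mult norm_minus_commute)

text \<open>The scale is a quarter of the distance from \<open>1 / u\<close> to 0, so the centre of
  the hole stays away from 0 and its inverse \<open>w\<close> has modulus comparable to
  \<open>R\<close>. Inversion there stretches lengths by a factor of order R^2, turning a radius of
  order c/R into one of order cR.\<close>

lemma hole_under_inversion:
  assumes u: "cmod (u - of_real (R/2)) \<le> R/7" and R: "R > 0" and c: "0 < c" "c < 1"
    and hole: "ball y (c * (1 / (4 * cmod u))) \<subseteq> ball (1 / u) (1 / (4 * cmod u)) - G"
  obtains w where "cmod (w - of_real (R/2)) \<le> 5 * R / 14"
    "\<And>v. cmod (v - w) < c * R / 392 \<Longrightarrow> 1 / v \<notin> G"
proof -
  have uR: "cmod u \<le> 9 * R / 14" "cmod u \<ge> 5 * R / 14"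
    using u norm_triangle_ineq2[of u "of_real (R/2)"] norm_triangle_ineq2[of "of_real (R/2)" u] R
    by (auto simp: norm_minus_commute)
  define s where "s = cmod u"
  have s: "s > 0" using uR R unfolding s_def by linarith
  \<comment> \<open>Positivity of \<open>c\<close> puts the centre in its own ball, so the inclusion
    of balls locates \<open>y\<close> near \<open>1 / u\<close>.\<close>
  have "y \<in> ball y (c * (1 / (4 * s)))" using s c by simp
  then have "y \<in> ball (1 / u) (1 / (4 * s))" using subsetD[OF hole, of y] by (simp only: s_def Diff_iff)
  then have y: "dist (1 / u) y < 1 / (4 * s)" by simp
  have nu: "cmod (1 / u) = 1 / s" by (simp add: s_def norm_divide)
  have ny: "cmod y \<ge> 3 / (4 * s)"
  proof -
    have "1 / s - cmod y \<le> dist (1 / u) y"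
      unfolding nu[symmetric] dist_norm by (rule norm_triangle_ineq2)
    then have "cmod y \<ge> 1 / s - 1 / (4 * s)" using y by linarith
    then show ?thesis using s by (simp add: field_simps)
  qed
  have y0: "y \<noteq> 0" using ny s by (auto simp: field_simps)
  define w where "w = 1 / y"
  have w0: "w \<noteq> 0" and yw: "y = 1 / w" using y0 by (auto simp: w_def)
  have "u \<noteq> 0" using s unfolding s_def zero_less_norm_iff .
  have nw: "cmod w \<le> 4 * s / 3"
    using ny s y0 by (simp add: w_def norm_divide field_simps)
  \<comment> \<open>Closeness of \<open>y\<close> to \<open>1 / u\<close> becomes relative closeness
    of \<open>w\<close> to \<open>u\<close>: their distance is at most s/3, hence at most 3R/14, and
    R/7 + 3R/14 = 5R/14.\<close>
  have "dist u w / (s * cmod w) < 1 / (4 * s)"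
    using y dist_inverse[OF \<open>u \<noteq> 0\<close> w0] by (simp add: yw s_def)
  then have "dist u w < cmod w / 4" using s w0 by (simp add: field_simps)
  then have "dist u w \<le> s / 3" using nw by linarith
  then have "cmod (w - u) \<le> 3 * R / 14" using uR by (simp add: dist_norm norm_minus_commute s_def)
  then have w1: "cmod (w - of_real (R/2)) \<le> 5 * R / 14"
    using u norm_triangle_ineq[of "w - u" "u - of_real (R/2)"] by simp
  then have w2: "cmod w \<ge> R/7"
    using norm_triangle_ineq2[of "of_real (R/2)" w] R by (simp add: norm_minus_commute)
  show thesis
  proof (rule that[OF w1])
    fix v assume v: "cmod (v - w) < c * R / 392"
    have "c * R \<le> R" using c R by simp
    then have "cmod (v - w) < R / 14" using v R by linarith
    then have v2: "cmod v \<ge> R / 14"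
      using w2 norm_triangle_ineq2[of w v] by (simp add: norm_minus_commute)
    then have "v \<noteq> 0" using R by auto
    have "dist y (1 / v) = cmod (v - w) / (cmod w * cmod v)"
      using dist_inverse[OF w0 \<open>v \<noteq> 0\<close>] by (simp add: yw dist_norm norm_minus_commute)
    also have "\<dots> \<le> cmod (v - w) / (R / 7 * (R / 14))"
      using v2 w2 R by (intro divide_left_mono mult_mono mult_pos_pos) auto
    also have "\<dots> < (c * R / 392) / (R / 7 * (R / 14))"
      using v R by (intro divide_strict_right_mono) auto
    \<comment> \<open>Here 392 = 4 * 7 * 14 pays for the lower bounds R/7 on \<open>cmod w\<close>
      and R/14 on \<open>cmod v\<close>; then \<open>s \<le> R\<close> compares the result with the
      radius of the hole.\<close>
    also have "\<dots> = c * (1 / (4 * R))" using R by (simp add: field_simps)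
    also have "\<dots> \<le> c * (1 / (4 * s))"
      using uR R s c by (intro mult_left_mono divide_left_mono) (auto simp: s_def)
    finally have "1 / v \<in> ball y (c * (1 / (4 * s)))" by simp
    then show "1 / v \<notin> G" using hole by (auto simp: s_def)
  qed
qed

section \<open>From holes to the density bound\<close>

text \<open>The inverted hole excludes the points \<open>e + z0\<close> from a ball of radius
  \<open>\<eta> * R\<close>. Since \<open>cmod z0 \<le> 1\<close>, the letters themselves avoid the
  ball with radius smaller by 1.\<close>

lemma porous_alphabet_gap:
  assumes I: "I \<subseteq> cf_alphabet" "I \<noteq> {}" and por: "porous_in_alphabet I"
  obtains \<eta> where "0 < \<eta>" "\<eta> < 1/392"
    "\<forall>\<^sub>F R in at_top. \<exists>w. cmod (w - of_real (R/2)) \<le> 5 * R / 14 \<and> I \<inter> ball w (\<eta> * R - 1) = {}"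
proof -
  define G where "G = closure (cf_limit_set I)"
  obtain c r0 where c: "0 < c" "c < 1" "r0 > 0"
    and hole: "\<And>x r. x \<in> G \<Longrightarrow> 0 < r \<Longrightarrow> r < r0 \<Longrightarrow> \<exists>y. ball y (c * r) \<subseteq> ball x r - G"
    using porous_obtains_hole por unfolding porous_in_alphabet_def G_def by metis
  obtain z0 where z0: "z0 \<in> cf_limit_set I" using cf_limit_set_nonempty[OF I(2)] by blast
  have nz0: "cmod z0 \<le> 1"
    using z0 cf_limit_set_subset[OF I(1)] cf_domain_norm_le by blast
  have inG: "1 / (e + z0) \<in> G" if "e \<in> I" for e
    using cf_map_in_limit_set[OF I(1) that z0] closure_subset unfolding cf_map_def G_def by blast
  define \<eta> where "\<eta> = c / 392"
  have "\<exists>w. cmod (w - of_real (R/2)) \<le> 5 * R / 14 \<and> I \<inter> ball w (\<eta> * R - 1) = {}"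
    if R: "R \<ge> 56" "R > 1 / r0" for R
  proof (cases "I \<inter> ball (of_real (R/2)) (\<eta> * R - 1) = {}")
    \<comment> \<open>With no letter near R/2, that point itself centres a gap.\<close>
    case True
    then show ?thesis using R by (intro exI[of _ "of_real (R/2)"]) auto
  next
    case False
    then obtain e where e: "e \<in> I" "dist (of_real (R/2)) e < \<eta> * R - 1" by auto
    define u where "u = e + z0"
    have "c * R \<le> R" using c R by simp
    have "u - of_real (R/2) = (e - of_real (R/2)) + z0" by (simp add: u_def)
    then have "cmod (u - of_real (R/2)) \<le> cmod (e - of_real (R/2)) + cmod z0"
      by (metis norm_triangle_ineq)
    also have "\<dots> \<le> \<eta> * R" using e(2) nz0 by (simp add: dist_norm norm_minus_commute)
    also have "\<dots> \<le> R/7" using \<open>c * R \<le> R\<close> R by (simp add: \<eta>_def)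
    finally have u: "cmod (u - of_real (R/2)) \<le> R/7" .
    have "cmod u \<ge> 5 * R / 14"
      using u norm_triangle_ineq2[of "of_real (R/2)" u] R by (simp add: norm_minus_commute)
    then have u4: "4 * cmod u > R" using R by linarith
    \<comment> \<open>\<open>4 * cmod u\<close> exceeds \<open>R\<close>, so
      \<open>R > 1 / r0\<close> brings the scale into the range of porosity.\<close>
    have "1 / (4 * cmod u) < r0"
    proof -
      have "1 < r0 * R" using R c by (simp add: field_simps)
      also have "\<dots> < r0 * (4 * cmod u)" using u4 c by (intro mult_strict_left_mono)
      finally have "1 < r0 * (4 * cmod u)" .
      moreover have "0 < 4 * cmod u" using u4 R by linarith
      ultimately show ?thesis by (simp only: pos_divide_less_eq)
    qed
    moreover have "0 < 1 / (4 * cmod u)"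
      using u4 R by (intro divide_pos_pos) linarith+
    ultimately obtain y where
      y: "ball y (c * (1 / (4 * cmod u))) \<subseteq> ball (1 / u) (1 / (4 * cmod u)) - G"
      using hole[OF inG[OF e(1)], of "1 / (4 * cmod u)"] unfolding u_def by blast
    obtain w where w: "cmod (w - of_real (R/2)) \<le> 5 * R / 14"
      and wG: "\<And>v. cmod (v - w) < c * R / 392 \<Longrightarrow> 1 / v \<notin> G"
      using hole_under_inversion[OF u _ c(1,2) y] R by auto
    have "e' \<notin> ball w (\<eta> * R - 1)" if "e' \<in> I" for e'
    proof
      assume "e' \<in> ball w (\<eta> * R - 1)"
      then have "cmod (e' - w) < \<eta> * R - 1" by (simp add: dist_norm norm_minus_commute)
      moreover have "cmod (e' + z0 - w) \<le> cmod (e' - w) + cmod z0"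
        using norm_triangle_ineq[of "e' - w" z0] by (simp add: algebra_simps)
      ultimately have "cmod (e' + z0 - w) < c * R / 392" using nz0 by (simp add: \<eta>_def)
      then show False using wG inG[OF that] by blast
    qed
    then show ?thesis using w by blast
  qed
  then have "\<forall>\<^sub>F R in at_top. \<exists>w. cmod (w - of_real (R/2)) \<le> 5 * R / 14 \<and> I \<inter> ball w (\<eta> * R - 1) = {}"
    using eventually_conj[OF eventually_ge_at_top[of 56] eventually_gt_at_top[of "1 / r0"]]
    by (auto elim: eventually_mono)
  moreover have "0 < \<eta>" "\<eta> < 1/392" using c by (auto simp: \<eta>_def)
  ultimately show thesis using that by blast
qed

text \<open>At least (\<eta>R/2)^2 letters of the square are missed, out of at most 6R^2; the
  quotient is \<eta>^2/24.\<close>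

lemma density_ratio_le:
  assumes I: "I \<subseteq> cf_alphabet" and R: "R \<ge> 1" and \<eta>: "0 < \<eta>" "\<eta> < 1/392" "\<eta> * R \<ge> 4"
    and w: "cmod (w - of_real (R/2)) \<le> 5 * R / 14" "I \<inter> ball w (\<eta> * R - 1) = {}"
  shows "real (card (I \<inter> cball_max 1 R)) / real (card (cf_alphabet \<inter> cball_max 1 R))
    \<le> 1 - \<eta>\<^sup>2 / 24"
proof -
  let ?E = "cf_alphabet \<inter> cball_max 1 R" and ?I = "I \<inter> cball_max 1 R"
  note E = card_cf_alphabet_square[OF R]
  have \<eta>R: "\<eta> * R \<le> R / 392" using \<eta> R by (simp add: field_simps)
  have wRe: "\<bar>Re w - R/2\<bar> \<le> 5 * R / 14" "\<bar>Im w\<bar> \<le> 5 * R / 14"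
    using w(1) abs_Re_le_cmod[of "w - of_real (R/2)"] abs_Im_le_cmod[of "w - of_real (R/2)"] by auto
  \<comment> \<open>Since 5/14 + 1/392 < 1/2, real parts stay between 0 and R and imaginary parts
    within R/2 of 0.\<close>
  have "ball w (\<eta> * R - 1) \<subseteq> cball_max 1 R"
  proof
    fix v assume "v \<in> ball w (\<eta> * R - 1)"
    then have "cmod (v - w) < \<eta> * R - 1" by (simp add: dist_norm norm_minus_commute)
    then have "\<bar>Re v - Re w\<bar> < \<eta> * R - 1" "\<bar>Im v - Im w\<bar> < \<eta> * R - 1"
      using abs_Re_le_cmod[of "v - w"] abs_Im_le_cmod[of "v - w"] by auto
    then show "v \<in> cball_max 1 R"
      using wRe \<eta>R R unfolding cball_max_def mem_Collect_eq minus_complex.sel one_complex.sel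
      by linarith
  qed
  then have sub: "cf_alphabet \<inter> ball w (\<eta> * R - 1) \<subseteq> ?E - ?I" using w(2) by blast
  \<comment> \<open>One unit is the margin in the radius, the other the rounding loss of the lattice
    count; \<open>\<eta> * R \<ge> 4\<close> makes them at most half of
    \<open>\<eta> * R\<close>.\<close>
  have "(\<eta> * R / 2)\<^sup>2 \<le> (\<eta> * R - 1 - 1)\<^sup>2" using \<eta>(3) by (intro power_mono) linarith+
  also have "\<dots> \<le> real (card (?E - ?I))"
  proof (rule card_cf_alphabet_ball_ge[OF _ _ _ sub])
    show "Re w \<ge> \<eta> * R - 1" using wRe(1) \<eta>R R by linarith
    show "1 \<le> \<eta> * R - 1" using \<eta>(3) by linarith
  qed (use E in auto)
  also have "card (?E - ?I) = card ?E - card ?I"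
    using I E(1) by (intro card_Diff_subset finite_subset[OF _ E(1)]) auto
  also have "real \<dots> = real (card ?E) - real (card ?I)"
    using I E(1) by (intro of_nat_diff card_mono) auto
  finally have gap: "\<eta>\<^sup>2 * R\<^sup>2 / 4 \<le> real (card ?E) - real (card ?I)"
    by (simp add: power_mult_distrib power_divide)
  have "\<eta>\<^sup>2 * R\<^sup>2 > 0" using \<eta> R by simp
  then have pos: "real (card ?E) > 0" using gap by linarith
  have "\<eta>\<^sup>2 / 24 * real (card ?E) \<le> \<eta>\<^sup>2 / 24 * (6 * R\<^sup>2)"
    using E(2) by (intro mult_left_mono) auto
  also have "\<dots> = \<eta>\<^sup>2 * R\<^sup>2 / 4" by simp
  finally have "real (card ?I) \<le> (1 - \<eta>\<^sup>2 / 24) * real (card ?E)"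
    using gap by (simp add: left_diff_distrib)
  then show ?thesis using pos by (simp add: pos_divide_le_eq)
qed

theorem proposition4p11:
  fixes I :: "complex set"
  assumes "I \<subseteq> cf_alphabet"
    and "porous_in_alphabet I"
  shows "upper_density cf_alphabet I < 1"
proof (cases "I = {}")
  \<comment> \<open>Without letters the limit set is empty and offers no base point; the ratio is
    constantly 0.\<close>
  case True
  then show ?thesis by (simp add: upper_density_def zero_ereal_def[symmetric] Limsup_const)
next
  case False
  obtain \<eta> where \<eta>: "0 < \<eta>" "\<eta> < 1/392" and gap:
    "\<forall>\<^sub>F R in at_top. \<exists>w. cmod (w - of_real (R/2)) \<le> 5 * R / 14 \<and> I \<inter> ball w (\<eta> * R - 1) = {}"
    using porous_alphabet_gap[OF assms(1) False assms(2)] by blast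
  have "\<forall>\<^sub>F R in at_top. ereal (real (card (I \<inter> cball_max 1 R)) /
      real (card (cf_alphabet \<inter> cball_max 1 R))) \<le> ereal (1 - \<eta>\<^sup>2 / 24)"
    using gap eventually_ge_at_top[of 1] eventually_ge_at_top[of "4 / \<eta>"]
  proof eventually_elim
    case (elim R)
    then have "\<eta> * R \<ge> 4" using \<eta> by (simp add: field_simps)
    with elim density_ratio_le[OF assms(1)] \<eta> show ?case by auto
  qed
  then have "upper_density cf_alphabet I \<le> ereal (1 - \<eta>\<^sup>2 / 24)"
    unfolding upper_density_def by (rule Limsup_bounded)
  also have "\<dots> < 1" using \<eta> by simp
  finally show ?thesis .
qed

end
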